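(* For any $\mathbf{X}\in\mathbb{R}^{d\times n}$ with no zero rows or columns, we have the bounds $$\|\mathbf{X}\|_F^2\le C_P(\mathbf{X})\le n\|\mathbf{X}\|_F^2\qquad\text{and}\qquad \|\mathbf{X}\|_F^2\le C_D(\mathbf{X})\le d\|\mathbf{X}\|_F^2.$$ It follows that $$\frac1d\le\frac{C_P(\mathbf{X})}{C_D(\mathbf{X})}\le n.$$ Moreover, all these bounds are tight.
   Context: For $\mathbf{X}\in\mathbb{R}^{d\times n}$, $\mathbf{X}_{i:}$ and $\mathbf{X}_{:j}$ denote the $i$-th row and $j$-th column, $\|\cdot\|_0$ is the number of nonzero entries, $\|\cdot\|$ is the Euclidean norm, $\|\cdot\|_F$ is the Frobenius norm, and $$C_P(\mathbf{X})=\sum_{i=1}^d\|\mathbf{X}_{i:}\|_0\|\mathbf{X}_{i:}\|^2,\qquad C_D(\mathbf{X})=\sum_{j=1}^n\|\mathbf{X}_{:j}\|_0\|\mathbf{X}_{:j}\|^2.$$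
   Formalization: Tight means the constant is best possible for each shape; the lower bounds on C_P and C_P/C_D exclude d=1<n, and the lower bound on C_D and upper bound on C_P/C_D exclude n=1<d, where tightness fails. Equality is shown for exactly the shapes that admit it. *)

theory Defs
  imports "HOL-Analysis.Analysis"
begin

text \<open>
  A matrix with d rows and n columns has type \<open>real ^ 'n ^ 'd\<close>, with
  \<open>d = CARD('d) \<ge> 1\<close> and \<open>n = CARD('n) \<ge> 1\<close>. The library norm on \<open>real ^ 'n\<close> is the
  Euclidean norm; the one on \<open>real ^ 'n ^ 'd\<close> is the Euclidean norm of the vector of
  row norms, i.e. the Frobenius norm.
\<close>

definition norm0 :: "real ^ 'k \<Rightarrow> nat" where
  "norm0 v = card {i. v $ i \<noteq> 0}"

definition C_P :: "real ^ 'n ^ 'd \<Rightarrow> real" where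
  "C_P X = (\<Sum>i\<in>UNIV. real (norm0 (row i X)) * (norm (row i X))\<^sup>2)"

definition C_D :: "real ^ 'n ^ 'd \<Rightarrow> real" where
  "C_D X = (\<Sum>j\<in>UNIV. real (norm0 (column j X)) * (norm (column j X))\<^sup>2)"

definition no_zero_row_col :: "real ^ 'n ^ 'd \<Rightarrow> bool" where
  "no_zero_row_col X \<longleftrightarrow> (\<forall>i. row i X \<noteq> 0) \<and> (\<forall>j. column j X \<noteq> 0)"

text \<open>
  A bound is tight for the shape (d, n) if its constant cannot be improved: every strictly
  better constant is violated by some matrix of that shape without zero rows or columns.
  The stronger property that equality is attained is a separate matter. For instance,
  \<open>C_P X = (norm X)\<^sup>2\<close> forces exactly one nonzero entry in each row, hence \<open>n \<le> d\<close>; and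
  \<open>C_P X / C_D X = 1 / d\<close> forces in addition full columns, hence \<open>n = 1\<close>.
  A matrix with a single row and no zero column has \<open>C_P X = n * (norm X)\<^sup>2\<close> and
  \<open>C_D X = (norm X)\<^sup>2\<close>, so for \<open>d = 1 < n\<close> the lower bounds on \<open>C_P X\<close> and on the ratio are
  not tight; dually, for \<open>n = 1 < d\<close> the lower bound on \<open>C_D X\<close> and the upper bound on the
  ratio are not tight.
\<close>

end

theory Submission
  imports Defs
begin

text \<open>
  Each row norm enters \<open>C_P X\<close> with a weight between 1 and n, and transposition exchanges
  \<open>C_P\<close> and \<open>C_D\<close>. The upper bounds are attained by the all-ones matrix, the lower bound
  \<open>(norm X)\<^sup>2 \<le> C_P X\<close> by the 0/1 matrix of a surjection from rows to columns when \<open>n \<le> d\<close>.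
  For \<open>d \<ge> 2\<close> consider a matrix supported on one full row and one full column, with a large
  entry t on the column off the crossing and 1 elsewhere on the support: as t grows,
  almost all the mass lies in rows with a single nonzero entry and in a full column, so
  \<open>C_P X\<close> is close to \<open>(norm X)\<^sup>2\<close> and \<open>C_D X\<close> is close to \<open>d * (norm X)\<^sup>2\<close>.
\<close>

section \<open>Norms, transposition and counts of nonzero entries\<close>

lemma norm_power2_vec: "(norm (v :: real ^ 'k))\<^sup>2 = (\<Sum>i\<in>UNIV. (v $ i)\<^sup>2)"
  unfolding power2_norm_eq_inner inner_vec_def by (simp add: power2_eq_square)

lemma norm_power2_rows: "(norm (X :: real ^ 'n ^ 'd))\<^sup>2 = (\<Sum>i\<in>UNIV. (norm (row i X))\<^sup>2)"
  by (simp add: power2_norm_eq_inner inner_vec_def row_def)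

lemma norm_transpose_matrix: "norm (transpose (X :: real ^ 'n ^ 'd)) = norm X"
proof -
  have "(norm (transpose X))\<^sup>2 = (norm X)\<^sup>2"
    unfolding norm_power2_rows norm_power2_vec
    by (simp add: row_def transpose_def) (rule sum.swap)
  then show ?thesis by simp
qed

lemma C_D_eq_C_P_transpose: "C_D X = C_P (transpose X)"
  by (simp add: C_D_def C_P_def)

lemma C_P_eq_C_D_transpose: "C_P X = C_D (transpose X)"
  by (simp add: C_D_def C_P_def)

lemma no_zero_row_col_transpose [simp]: "no_zero_row_col (transpose X) \<longleftrightarrow> no_zero_row_col X"
  by (auto simp: no_zero_row_col_def)

lemma norm0_ge_1: "v \<noteq> 0 \<Longrightarrow> 1 \<le> norm0 v"
  by (auto simp: norm0_def vec_eq_iff Suc_le_eq card_gt_0_iff)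

lemma norm0_le_card: "norm0 (v :: real ^ 'k) \<le> CARD('k)"
  by (auto simp: norm0_def intro: card_mono)

lemma norm0_full:
  assumes "\<And>i. (v :: real ^ 'k) $ i \<noteq> 0"
  shows "norm0 v = CARD('k)"
  using assms by (simp add: norm0_def)

section \<open>Bounds by the Frobenius norm and bounds on the ratio\<close>

lemma norm_power2_le_C_P:
  assumes "no_zero_row_col X"
  shows "(norm X)\<^sup>2 \<le> C_P X"
proof -
  have "1 * (norm (row i X))\<^sup>2 \<le> real (norm0 (row i X)) * (norm (row i X))\<^sup>2" for i
    using assms norm0_ge_1[of "row i X"]
    by (intro mult_right_mono) (auto simp: no_zero_row_col_def)
  then show ?thesis unfolding norm_power2_rows C_P_def by (intro sum_mono) simp
qed

lemma C_P_le_card_mult_norm: "C_P (X :: real ^ 'n ^ 'd) \<le> real CARD('n) * (norm X)\<^sup>2"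
  unfolding norm_power2_rows C_P_def sum_distrib_left
  by (intro sum_mono mult_right_mono) (simp_all add: norm0_le_card)

lemma norm_power2_le_C_D: "no_zero_row_col X \<Longrightarrow> (norm X)\<^sup>2 \<le> C_D X"
  using norm_power2_le_C_P[of "transpose X"]
  by (simp add: norm_transpose_matrix C_D_eq_C_P_transpose)

lemma C_D_le_card_mult_norm: "C_D (X :: real ^ 'n ^ 'd) \<le> real CARD('d) * (norm X)\<^sup>2"
  using C_P_le_card_mult_norm[of "transpose X"]
  by (simp add: norm_transpose_matrix C_D_eq_C_P_transpose)

lemma no_zero_row_col_norm_pos: "no_zero_row_col X \<Longrightarrow> 0 < (norm X)\<^sup>2"
  by (auto simp: no_zero_row_col_def row_def)

lemma C_D_pos: "no_zero_row_col X \<Longrightarrow> 0 < C_D X"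
  using norm_power2_le_C_D[of X] no_zero_row_col_norm_pos[of X] by linarith

text \<open>Both bounds compare \<open>C_P X\<close> and \<open>C_D X\<close> through
  \<open>(norm X)\<^sup>2\<close>: an upper bound for one is chained with the lower bound for the
  other.\<close>

lemma C_P_div_C_D_bounds:
  fixes X :: "real ^ 'n ^ 'd"
  assumes X: "no_zero_row_col X"
  shows "1 / real CARD('d) \<le> C_P X / C_D X" "C_P X / C_D X \<le> real CARD('n)"
proof -
  have d: "0 < real CARD('d)" by simp
  have "C_D X \<le> real CARD('d) * C_P X"
    by (rule order_trans[OF C_D_le_card_mult_norm mult_left_mono[OF norm_power2_le_C_P[OF X]]]) simp
  then show "1 / real CARD('d) \<le> C_P X / C_D X"
    using C_D_pos[OF X] d by (simp add: divide_simps mult.commute)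
  have "C_P X \<le> real CARD('n) * C_D X"
    by (rule order_trans[OF C_P_le_card_mult_norm mult_left_mono[OF norm_power2_le_C_D[OF X]]]) simp
  then show "C_P X / C_D X \<le> real CARD('n)"
    using C_D_pos[OF X] by (simp add: divide_simps mult.commute)
qed

section \<open>Extremal and nearly extremal matrices\<close>

lemma C_P_full:
  assumes "\<And>i j. (X :: real ^ 'n ^ 'd) $ i $ j \<noteq> 0"
  shows "C_P X = real CARD('n) * (norm X)\<^sup>2"
  unfolding norm_power2_rows C_P_def sum_distrib_left
  using assms by (intro sum.cong) (simp_all add: norm0_full row_def)

lemma ex_full_matrix:
  "\<exists>X :: real ^ 'n ^ 'd. no_zero_row_col X \<and> C_P X = real CARD('n) * (norm X)\<^sup>2 \<and>
     C_D X = real CARD('d) * (norm X)\<^sup>2"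
proof (intro exI conjI)
  let ?X = "(\<chi> i j. 1) :: real ^ 'n ^ 'd"
  show "no_zero_row_col ?X"
    by (simp add: no_zero_row_col_def row_def column_def vec_eq_iff)
  show "C_P ?X = real CARD('n) * (norm ?X)\<^sup>2"
    by (rule C_P_full) simp
  have "C_P (transpose ?X) = real CARD('d) * (norm (transpose ?X))\<^sup>2"
    by (rule C_P_full) (simp add: transpose_def)
  then show "C_D ?X = real CARD('d) * (norm ?X)\<^sup>2"
    by (simp add: C_D_eq_C_P_transpose norm_transpose_matrix)
qed

lemma ex_C_P_eq_norm:
  assumes "CARD('n) \<le> CARD('d)"
  shows "\<exists>X :: real ^ 'n ^ 'd. no_zero_row_col X \<and> C_P X = (norm X)\<^sup>2"
proof -
  obtain g :: "'n \<Rightarrow> 'd" where "inj g"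
    using assms card_le_inj[of "UNIV :: 'n set" "UNIV :: 'd set"] by auto
  then obtain f :: "'d \<Rightarrow> 'n" where f: "surj f"
    using inj_imp_surj_inv by blast
  \<comment> \<open>Since \<open>f\<close> is a function, each row has a single nonzero entry; since
    it is onto, no column vanishes.\<close>
  let ?X = "(\<chi> i j. if j = f i then 1 else 0) :: real ^ 'n ^ 'd"
  have "no_zero_row_col ?X"
    using f by (force simp: no_zero_row_col_def row_def column_def vec_eq_iff surj_def)
  moreover have "norm0 (row i ?X) = 1" for i
    by (simp add: norm0_def row_def)
  then have "C_P ?X = (norm ?X)\<^sup>2"
    by (simp add: C_P_def norm_power2_rows)
  ultimately show ?thesis by blast
qed

text \<open>Here \<open>s\<close> is the squared mass of the full column off the crossing. It has
  weight 1 in \<open>C_P X\<close> and weight d in \<open>C_D X\<close>; everything else stays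
  bounded by a function of n alone in \<open>C_P X\<close>.\<close>

lemma ex_cross_matrix:
  fixes t :: real
  assumes "t \<noteq> 0"
  defines "s \<equiv> (real CARD('d) - 1) * t\<^sup>2"
  shows "\<exists>X :: real ^ 'n ^ 'd. no_zero_row_col X \<and> (norm X)\<^sup>2 = s + real CARD('n) \<and>
    C_P X = s + (real CARD('n))\<^sup>2 \<and> real CARD('d) * (s + 1) \<le> C_D X"
proof -
  \<comment> \<open>The full row \<open>a\<close> and the full column \<open>b\<close> are
    arbitrary; the entry where they cross is 1.\<close>
  obtain a :: 'd where True by simp
  obtain b :: 'n where True by simp
  define X :: "real ^ 'n ^ 'd" where
    "X = (\<chi> i j. if i = a then 1 else if j = b then t else 0)"
  have nz: "no_zero_row_col X"
    using assms(1) by (auto simp: no_zero_row_col_def X_def row_def column_def vec_eq_iff)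
  have row_a: "norm0 (row a X) = CARD('n)" "(norm (row a X))\<^sup>2 = real CARD('n)"
    by (simp_all add: norm0_full norm_power2_vec X_def row_def)
  have row_ne: "norm0 (row i X) = 1" "(norm (row i X))\<^sup>2 = t\<^sup>2" if "i \<noteq> a" for i
  proof -
    show "norm0 (row i X) = 1"
      using that assms(1) by (simp add: norm0_def X_def row_def)
    have "(norm (row i X))\<^sup>2 = (\<Sum>j\<in>UNIV. if j = b then t\<^sup>2 else 0)"
      unfolding norm_power2_vec using that by (intro sum.cong) (auto simp: X_def row_def)
    then show "(norm (row i X))\<^sup>2 = t\<^sup>2" by simp
  qed
  have card: "real (card (UNIV - {a})) = real CARD('d) - 1"
    by (simp add: card_Diff_singleton of_nat_diff Suc_le_eq)
  have norm: "(norm X)\<^sup>2 = s + real CARD('n)"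
    unfolding norm_power2_rows
    by (subst sum.remove[of _ a]) (simp_all add: row_a row_ne card s_def del: card_Diff_insert)
  have C_P: "C_P X = s + (real CARD('n))\<^sup>2"
    unfolding C_P_def
    by (subst sum.remove[of _ a])
      (simp_all add: row_a row_ne card s_def del: card_Diff_insert flip: power2_eq_square)
  have "norm0 (column b X) = CARD('d)"
    using assms(1) by (intro norm0_full) (simp add: X_def column_def)
  moreover have "(norm (column b X))\<^sup>2 = s + 1"
    unfolding norm_power2_vec
    by (subst sum.remove[of _ a])
      (simp_all add: X_def column_def card s_def del: card_Diff_insert)
  ultimately have "real CARD('d) * (s + 1) = real (norm0 (column b X)) * (norm (column b X))\<^sup>2"
    by simp
  \<comment> \<open>The remaining columns contribute nonnegative terms, so column \<open>b\<close>
    alone gives the lower bound.\<close>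
  also have "\<dots> \<le> C_D X"
    unfolding C_D_def by (intro member_le_sum) auto
  finally show ?thesis using nz norm C_P by blast
qed

text \<open>One witness serves the norm bound and the ratio bound. For n = 1 the all-ones matrix
  attains both; otherwise d is at least 2 and the cross matrix applies.\<close>

lemma ex_near_tight:
  fixes c :: real
  assumes dn: "CARD('d) \<ge> 2 \<or> CARD('n) = 1" and c: "c > 1"
  shows "\<exists>X :: real ^ 'n ^ 'd. no_zero_row_col X \<and> C_P X < c * (norm X)\<^sup>2 \<and>
    real CARD('d) * C_P X < c * C_D X"
proof (cases "CARD('n) = 1")
  case True
  obtain X :: "real ^ 'n ^ 'd" where X: "no_zero_row_col X"
    "C_P X = real CARD('n) * (norm X)\<^sup>2" "C_D X = real CARD('d) * (norm X)\<^sup>2"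
    using ex_full_matrix by blast
  have "0 < (norm X)\<^sup>2" "0 < C_D X" using no_zero_row_col_norm_pos C_D_pos X(1) by auto
  then have "(norm X)\<^sup>2 < c * (norm X)\<^sup>2" "C_D X < c * C_D X" using c by simp_all
  then show ?thesis using X True by (intro exI[of _ X]) simp
next
  case False
  let ?n = "real CARD('n)" and ?d = "real CARD('d)"
  \<comment> \<open>Chosen so that \<open>(c - 1) * t\<close> exceeds \<open>?n\<^sup>2\<close>; as
    \<open>t \<le> s\<close>, this absorbs the contribution of the full row into
    \<open>c * s\<close>.\<close>
  define t where "t = 1 + ?n\<^sup>2 / (c - 1)"
  define s where "s = (?d - 1) * t\<^sup>2"
  have t1: "1 \<le> t" using c by (simp add: t_def)
  have "t \<le> t\<^sup>2" using t1 by (simp add: power2_eq_square)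
  \<comment> \<open>This is where d at least 2 enters: the factor \<open>?d - 1\<close> is at least
    1.\<close>
  also have "\<dots> \<le> s" using dn False unfolding s_def by (simp add: mult_le_cancel_right1)
  finally have "t \<le> s" .
  then have "(c - 1) * t \<le> (c - 1) * s" using c by (intro mult_left_mono) auto
  moreover have "(c - 1) * t = (c - 1) + ?n\<^sup>2" using c by (simp add: t_def field_simps)
  ultimately have s: "s + ?n\<^sup>2 < c * s" using c by (simp add: algebra_simps)
  obtain X :: "real ^ 'n ^ 'd" where X: "no_zero_row_col X" "(norm X)\<^sup>2 = s + ?n"
    "C_P X = s + ?n\<^sup>2" "?d * (s + 1) \<le> C_D X"
    using ex_cross_matrix[of t, where 'n = 'n and 'd = 'd] t1 unfolding s_def by auto
  have "C_P X < c * (norm X)\<^sup>2"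
    unfolding X(2,3) distrib_left using s c by (intro less_trans[OF s]) simp
  moreover have "?d * C_P X < c * C_D X"
  proof -
    have "?d * C_P X < ?d * (c * s)"
      unfolding X(3) using s by simp
    also have "\<dots> \<le> c * (?d * (s + 1))" using c by (simp add: algebra_simps)
    also have "\<dots> \<le> c * C_D X" using X(4) c by (intro mult_left_mono) auto
    finally show ?thesis .
  qed
  ultimately show ?thesis using X(1) by blast
qed

lemma ex_near_tight_dual:
  fixes c :: real
  assumes "CARD('n) \<ge> 2 \<or> CARD('d) = 1" and "c > 1"
  shows "\<exists>X :: real ^ 'n ^ 'd. no_zero_row_col X \<and> C_D X < c * (norm X)\<^sup>2 \<and>
    real CARD('n) * C_D X < c * C_P X"
proof -
  obtain Y :: "real ^ 'd ^ 'n" where "no_zero_row_col Y" "C_P Y < c * (norm Y)\<^sup>2"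
    "real CARD('n) * C_P Y < c * C_D Y"
    using ex_near_tight[OF assms] by blast
  then show ?thesis
    by (intro exI[of _ "transpose Y"])
      (simp add: norm_transpose_matrix flip: C_D_eq_C_P_transpose C_P_eq_C_D_transpose)
qed

lemma ex_C_D_eq_norm:
  assumes "CARD('d) \<le> CARD('n)"
  shows "\<exists>X :: real ^ 'n ^ 'd. no_zero_row_col X \<and> C_D X = (norm X)\<^sup>2"
proof -
  obtain Y :: "real ^ 'd ^ 'n" where "no_zero_row_col Y" "C_P Y = (norm Y)\<^sup>2"
    using ex_C_P_eq_norm[OF assms] by blast
  then show ?thesis
    by (intro exI[of _ "transpose Y"])
      (simp add: norm_transpose_matrix flip: C_P_eq_C_D_transpose)
qed

section \<open>Tightness of the ratio bounds\<close>

lemma ex_ratio_less: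
  fixes c :: real
  assumes "CARD('d) \<ge> 2 \<or> CARD('n) = 1" and c: "c > 1 / real CARD('d)"
  shows "\<exists>X :: real ^ 'n ^ 'd. no_zero_row_col X \<and> C_P X / C_D X < c"
proof -
  have "1 < real CARD('d) * c" using c by (simp add: field_simps)
  from ex_near_tight[OF assms(1) this] obtain X :: "real ^ 'n ^ 'd"
    where X: "no_zero_row_col X" "real CARD('d) * C_P X < real CARD('d) * c * C_D X" by blast
  from X(2) have "C_P X < c * C_D X" by (simp add: mult.assoc)
  then show ?thesis using X(1) C_D_pos[OF X(1)] by (auto simp: pos_divide_less_eq)
qed

lemma ex_ratio_greater:
  fixes c :: real
  assumes "CARD('n) \<ge> 2 \<or> CARD('d) = 1" and c: "c < real CARD('n)"
  shows "\<exists>X :: real ^ 'n ^ 'd. no_zero_row_col X \<and> C_P X / C_D X > c"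
proof -
  let ?n = "real CARD('n)"
  \<comment> \<open>\<open>c\<close> may be nonpositive, while the perturbed constant is obtained by dividing by it.\<close>
  define c' where "c' = max c (?n / 2)"
  have c': "0 < c'" "c' < ?n" "c \<le> c'" using c by (auto simp: c'_def less_max_iff_disj)
  then have "1 < ?n / c'" by simp
  from ex_near_tight_dual[OF assms(1) this] obtain X :: "real ^ 'n ^ 'd"
    where X: "no_zero_row_col X" "?n * C_D X < ?n / c' * C_P X" by blast
  have "c' * C_D X < C_P X" using X(2) c' by (simp add: field_simps)
  then have "c' < C_P X / C_D X" using C_D_pos[OF X(1)] by (simp add: pos_less_divide_eq)
  then show ?thesis using X(1) c' by (intro exI[of _ X]) auto
qed

text \<open>The all-ones ratio equals the lower bound 1/d when n = 1 and the upper bound n when d =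
  1, which settles both cases of attained equality.\<close>

lemma ex_ratio_eq:
  "\<exists>X :: real ^ 'n ^ 'd. no_zero_row_col X \<and> C_P X / C_D X = real CARD('n) / real CARD('d)"
proof -
  obtain X :: "real ^ 'n ^ 'd" where X: "no_zero_row_col X"
    "C_P X = real CARD('n) * (norm X)\<^sup>2" "C_D X = real CARD('d) * (norm X)\<^sup>2"
    using ex_full_matrix by blast
  then show ?thesis
    using no_zero_row_col_norm_pos[OF X(1)] by (intro exI[of _ X]) simp
qed

theorem theorem3:
  shows "(\<forall>X :: real ^ 'n ^ 'd. no_zero_row_col X \<longrightarrow>
      (norm X)\<^sup>2 \<le> C_P X \<and> C_P X \<le> real CARD('n) * (norm X)\<^sup>2 \<and>
      (norm X)\<^sup>2 \<le> C_D X \<and> C_D X \<le> real CARD('d) * (norm X)\<^sup>2 \<and>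
      1 / real CARD('d) \<le> C_P X / C_D X \<and> C_P X / C_D X \<le> real CARD('n)) \<and>
    \<comment> \<open>tightness of \<open>(norm X)\<^sup>2 \<le> C_P X\<close>\<close>
    (CARD('d) \<ge> 2 \<or> CARD('n) = 1 \<longrightarrow>
      (\<forall>c > 1. \<exists>X :: real ^ 'n ^ 'd. no_zero_row_col X \<and> C_P X < c * (norm X)\<^sup>2)) \<and>
    (CARD('n) \<le> CARD('d) \<longrightarrow>
      (\<exists>X :: real ^ 'n ^ 'd. no_zero_row_col X \<and> C_P X = (norm X)\<^sup>2)) \<and>
    \<comment> \<open>tightness of \<open>C_P X \<le> n * (norm X)\<^sup>2\<close>\<close>
    (\<exists>X :: real ^ 'n ^ 'd. no_zero_row_col X \<and> C_P X = real CARD('n) * (norm X)\<^sup>2) \<and>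
    \<comment> \<open>tightness of \<open>(norm X)\<^sup>2 \<le> C_D X\<close>\<close>
    (CARD('n) \<ge> 2 \<or> CARD('d) = 1 \<longrightarrow>
      (\<forall>c > 1. \<exists>X :: real ^ 'n ^ 'd. no_zero_row_col X \<and> C_D X < c * (norm X)\<^sup>2)) \<and>
    (CARD('d) \<le> CARD('n) \<longrightarrow>
      (\<exists>X :: real ^ 'n ^ 'd. no_zero_row_col X \<and> C_D X = (norm X)\<^sup>2)) \<and>
    \<comment> \<open>tightness of \<open>C_D X \<le> d * (norm X)\<^sup>2\<close>\<close>
    (\<exists>X :: real ^ 'n ^ 'd. no_zero_row_col X \<and> C_D X = real CARD('d) * (norm X)\<^sup>2) \<and>
    \<comment> \<open>tightness of \<open>1 / d \<le> C_P X / C_D X\<close>\<close>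
    (CARD('d) \<ge> 2 \<or> CARD('n) = 1 \<longrightarrow>
      (\<forall>c > 1 / real CARD('d). \<exists>X :: real ^ 'n ^ 'd. no_zero_row_col X \<and> C_P X / C_D X < c)) \<and>
    (CARD('n) = 1 \<longrightarrow>
      (\<exists>X :: real ^ 'n ^ 'd. no_zero_row_col X \<and> C_P X / C_D X = 1 / real CARD('d))) \<and>
    \<comment> \<open>tightness of \<open>C_P X / C_D X \<le> n\<close>\<close>
    (CARD('n) \<ge> 2 \<or> CARD('d) = 1 \<longrightarrow>
      (\<forall>c < real CARD('n). \<exists>X :: real ^ 'n ^ 'd. no_zero_row_col X \<and> C_P X / C_D X > c)) \<and>
    (CARD('d) = 1 \<longrightarrow>
      (\<exists>X :: real ^ 'n ^ 'd. no_zero_row_col X \<and> C_P X / C_D X = real CARD('n)))"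
proof (intro conjI allI impI)
  fix X :: "real ^ 'n ^ 'd"
  assume X: "no_zero_row_col X"
  show "(norm X)\<^sup>2 \<le> C_P X" "C_P X \<le> real CARD('n) * (norm X)\<^sup>2"
    "(norm X)\<^sup>2 \<le> C_D X" "C_D X \<le> real CARD('d) * (norm X)\<^sup>2"
    "1 / real CARD('d) \<le> C_P X / C_D X" "C_P X / C_D X \<le> real CARD('n)"
    using X by (simp_all add: norm_power2_le_C_P C_P_le_card_mult_norm norm_power2_le_C_D
        C_D_le_card_mult_norm C_P_div_C_D_bounds)
next
  show "\<exists>X :: real ^ 'n ^ 'd. no_zero_row_col X \<and> C_P X < c * (norm X)\<^sup>2"
    if "CARD('d) \<ge> 2 \<or> CARD('n) = 1" "c > 1" for c
    using ex_near_tight[OF that] by blast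
  show "\<exists>X :: real ^ 'n ^ 'd. no_zero_row_col X \<and> C_P X = (norm X)\<^sup>2"
    if "CARD('n) \<le> CARD('d)"
    using that by (rule ex_C_P_eq_norm)
  show "\<exists>X :: real ^ 'n ^ 'd. no_zero_row_col X \<and> C_P X = real CARD('n) * (norm X)\<^sup>2"
    using ex_full_matrix by blast
  show "\<exists>X :: real ^ 'n ^ 'd. no_zero_row_col X \<and> C_D X < c * (norm X)\<^sup>2"
    if "CARD('n) \<ge> 2 \<or> CARD('d) = 1" "c > 1" for c
    using ex_near_tight_dual[OF that] by blast
  show "\<exists>X :: real ^ 'n ^ 'd. no_zero_row_col X \<and> C_D X = (norm X)\<^sup>2"
    if "CARD('d) \<le> CARD('n)"
    using that by (rule ex_C_D_eq_norm)
  show "\<exists>X :: real ^ 'n ^ 'd. no_zero_row_col X \<and> C_D X = real CARD('d) * (norm X)\<^sup>2"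
    using ex_full_matrix by blast
  show "\<exists>X :: real ^ 'n ^ 'd. no_zero_row_col X \<and> C_P X / C_D X < c"
    if "CARD('d) \<ge> 2 \<or> CARD('n) = 1" "c > 1 / real CARD('d)" for c
    using that by (rule ex_ratio_less)
  show "\<exists>X :: real ^ 'n ^ 'd. no_zero_row_col X \<and> C_P X / C_D X = 1 / real CARD('d)"
    if "CARD('n) = 1"
    using ex_ratio_eq[where 'n = 'n and 'd = 'd] that by simp
  show "\<exists>X :: real ^ 'n ^ 'd. no_zero_row_col X \<and> C_P X / C_D X > c"
    if "CARD('n) \<ge> 2 \<or> CARD('d) = 1" "c < real CARD('n)" for c
    using that by (rule ex_ratio_greater)
  show "\<exists>X :: real ^ 'n ^ 'd. no_zero_row_col X \<and> C_P X / C_D X = real CARD('n)"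
    if "CARD('d) = 1"
    using ex_ratio_eq[where 'n = 'n and 'd = 'd] that by simp
qed

end
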